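(* If $(G,\rho)$ is a P-framework, then $G$ contains no 3-cycles, and every two distinct vertices of $G$ are separated by a ribbon, i.e. for all distinct $u,v\in V_G$ there is a ribbon $r$ such that $u$ and $v$ lie in different connected components of $(V_G,E_G\setminus r)$.
   Context: For a graph $G$, two edges are related if they are opposite edges of a 4-cycle subgraph of $G$; a ribbon is an equivalence class of the reflexive–transitive closure of this relation. A set of edges $r$ is an edge cut of a connected graph $G$ if $(V_G,E_G\setminus r)$ is disconnected. A ribbon-cutting graph is a connected graph in which every ribbon is an edge cut. A parallelogram placement of a connected graph $G$ is an injective map $\rho:V_G\to\mathbb{R}^2$ such that every 4-cycle $(u_1,u_2,u_3,u_4)$ of $G$ forms a parallelogram, i.e. $\rho(u_2)-\rho(u_1)=\rho(u_3)-\rho(u_4)$. A P-framework is a pair $(G,\rho)$ with $G$ ribbon-cutting and $\rho$ a parallelogram placement of $G$. *)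

theory Defs
  imports "HOL-Analysis.Analysis"
begin

text \<open>
  A graph is a pair of a vertex set \<open>V\<close> and a set \<open>E\<close> of two-element subsets of \<open>V\<close>.
  It may be infinite.
\<close>

definition simple_graph :: "'a set \<Rightarrow> 'a set set \<Rightarrow> bool" where
  "simple_graph V E \<longleftrightarrow> (\<forall>e\<in>E. \<exists>u\<in>V. \<exists>v\<in>V. u \<noteq> v \<and> e = {u, v})"

definition adj_rel :: "'a set set \<Rightarrow> ('a \<times> 'a) set" where
  "adj_rel E = {(u, v). {u, v} \<in> E}"

definition connected_components :: "'a set \<Rightarrow> 'a set set \<Rightarrow> 'a set set" where
  "connected_components V E = V // (adj_rel E)\<^sup>*"

definition connected_graph :: "'a set \<Rightarrow> 'a set set \<Rightarrow> bool" where
  "connected_graph V E \<longleftrightarrow> simple_graph V E \<and> V \<noteq> {} \<and> (\<forall>u\<in>V. \<forall>v\<in>V. (u, v) \<in> (adj_rel E)\<^sup>*)"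

definition three_cycle :: "'a set set \<Rightarrow> 'a \<Rightarrow> 'a \<Rightarrow> 'a \<Rightarrow> bool" where
  "three_cycle E u1 u2 u3 \<longleftrightarrow>
     distinct [u1, u2, u3] \<and> {u1, u2} \<in> E \<and> {u2, u3} \<in> E \<and> {u3, u1} \<in> E"

text \<open>Four-cycles are subgraphs, not necessarily induced ones: diagonals are allowed.\<close>

definition four_cycle :: "'a set set \<Rightarrow> 'a \<Rightarrow> 'a \<Rightarrow> 'a \<Rightarrow> 'a \<Rightarrow> bool" where
  "four_cycle E u1 u2 u3 u4 \<longleftrightarrow>
     distinct [u1, u2, u3, u4] \<and>
     {u1, u2} \<in> E \<and> {u2, u3} \<in> E \<and> {u3, u4} \<in> E \<and> {u4, u1} \<in> E"

text \<open>
  The other pair of opposite edges of a four-cycle is covered by rotating its labelling;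
  for the same reason the relation is symmetric.
\<close>

definition opposite_rel :: "'a set set \<Rightarrow> ('a set \<times> 'a set) set" where
  "opposite_rel E =
     {(e, f). \<exists>u1 u2 u3 u4. four_cycle E u1 u2 u3 u4 \<and> e = {u1, u2} \<and> f = {u3, u4}}"

definition ribbons :: "'a set set \<Rightarrow> 'a set set set" where
  "ribbons E = E // (opposite_rel E)\<^sup>*"

definition edge_cut :: "'a set \<Rightarrow> 'a set set \<Rightarrow> 'a set set \<Rightarrow> bool" where
  "edge_cut V E r \<longleftrightarrow> r \<subseteq> E \<and> \<not> connected_graph V (E - r)"

definition ribbon_cutting :: "'a set \<Rightarrow> 'a set set \<Rightarrow> bool" where
  "ribbon_cutting V E \<longleftrightarrow> connected_graph V E \<and> (\<forall>r\<in>ribbons E. edge_cut V E r)"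

definition parallelogram_placement :: "'a set \<Rightarrow> 'a set set \<Rightarrow> ('a \<Rightarrow> real^2) \<Rightarrow> bool" where
  "parallelogram_placement V E \<rho> \<longleftrightarrow>
     connected_graph V E \<and> inj_on \<rho> V \<and>
     (\<forall>u1 u2 u3 u4. four_cycle E u1 u2 u3 u4 \<longrightarrow> \<rho> u2 - \<rho> u1 = \<rho> u3 - \<rho> u4)"

definition P_framework :: "'a set \<Rightarrow> 'a set set \<Rightarrow> ('a \<Rightarrow> real^2) \<Rightarrow> bool" where
  "P_framework V E \<rho> \<longleftrightarrow> ribbon_cutting V E \<and> parallelogram_placement V E \<rho>"

definition in_different_components :: "'a set \<Rightarrow> 'a set set \<Rightarrow> 'a \<Rightarrow> 'a \<Rightarrow> bool" where
  "in_different_components V E u v \<longleftrightarrow>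
     (\<exists>C\<in>connected_components V E. \<exists>D\<in>connected_components V E. u \<in> C \<and> v \<in> D \<and> C \<noteq> D)"

end

theory Submission imports Defs begin

text \<open>
  Opposite edges of a parallelogram are translates of each other, so all edges of a ribbon \<open>r\<close>
  are parallel to one vector \<open>w\<close>. As \<open>\<rho>\<close> is injective, no two adjacent edges of a four-cycle lie in
  the same ribbon; hence the two connecting edges of a four-cycle with opposite edges in \<open>r\<close> survive
  in \<open>G - r\<close>, and all edges of \<open>r\<close> lead, with displacement \<open>w\<close>, from one component of \<open>G - r\<close>
  to another one. So every closed walk meets each ribbon an even number of times, which excludes
  odd cycles. On a walk between vertices not separated by \<open>r\<close> the crossings of \<open>r\<close> alternate in
  direction and their displacements cancel. If this happens for every ribbon, then the end points of
  the walk have the same image under \<open>\<rho>\<close>.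
\<close>

section \<open>Reachability, four-cycles and ribbons as equivalence classes\<close>

lemma adj_rtrancl_sym: "(x, y) \<in> (adj_rel E)\<^sup>* \<Longrightarrow> (y, x) \<in> (adj_rel E)\<^sup>*"
proof -
  have "sym (adj_rel E)"
    by (auto simp: adj_rel_def sym_def insert_commute)
  then show "(x, y) \<in> (adj_rel E)\<^sup>* \<Longrightarrow> (y, x) \<in> (adj_rel E)\<^sup>*"
    by (meson sym_rtrancl symD)
qed

lemma four_cycle_reverse: "four_cycle E a b c d \<Longrightarrow> four_cycle E b a d c"
  by (auto simp: four_cycle_def insert_commute)

lemma four_cycle_half_turn: "four_cycle E a b c d \<Longrightarrow> four_cycle E c d a b"
  by (auto simp: four_cycle_def)

lemma sym_opposite_rel: "sym (opposite_rel E)"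
  unfolding sym_def opposite_rel_def by (blast intro: four_cycle_half_turn)

text \<open>Edges are unordered, so \<open>{x, y}\<close> may match the first edge of the cycle in
  either orientation; reversing the cycle handles the second case. Inductions along a ribbon can
  thus keep a chosen orientation.\<close>

lemma opposite_rel_from:
  assumes "({x, y}, f) \<in> opposite_rel E"
  obtains c d where "four_cycle E x y c d" "f = {c, d}"
proof -
  obtain u1 u2 u3 u4 where fc: "four_cycle E u1 u2 u3 u4" "{x, y} = {u1, u2}" "f = {u3, u4}"
    using assms unfolding opposite_rel_def by blast
  then consider "x = u1" "y = u2" | "x = u2" "y = u1"
    by (auto simp: doubleton_eq_iff)
  then show thesis
  proof cases
    case 1
    then show thesis using fc that by blast
  next
    case 2
    then show thesis using fc that[of u4 u3] four_cycle_reverse[OF fc(1)]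
      by (simp add: insert_commute)
  qed
qed

lemma equiv_opposite_rtrancl: "equiv UNIV ((opposite_rel E)\<^sup>*)"
  by (simp add: equivI refl_rtrancl sym_rtrancl sym_opposite_rel trans_rtrancl)

text \<open>Any member represents its class, so an induction along a ribbon can start at whichever
  edge is convenient.\<close>

lemma ribbon_eq_class:
  assumes "r \<in> ribbons E" "e \<in> r"
  shows "r = (opposite_rel E)\<^sup>* `` {e}"
proof -
  obtain f where f: "r = (opposite_rel E)\<^sup>* `` {f}"
    using assms(1) unfolding ribbons_def by (rule quotientE)
  with assms(2) have "(f, e) \<in> (opposite_rel E)\<^sup>*" by simp
  with f show ?thesis
    using equiv_class_eq[OF equiv_opposite_rtrancl] by blast
qed

lemma ribbon_of_edge:
  assumes "e \<in> E"
  shows "(opposite_rel E)\<^sup>* `` {e} \<in> ribbons E" "e \<in> (opposite_rel E)\<^sup>* `` {e}"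
  using assms by (auto simp: ribbons_def quotient_def)

lemma ribbon_disjoint:
  assumes "r \<in> ribbons E" "s \<in> ribbons E" "e \<in> r" "e \<in> s"
  shows "r = s"
  using ribbon_eq_class assms by metis

lemma ribbon_obtain_edge:
  assumes "r \<in> ribbons E"
  obtains e where "e \<in> E" "e \<in> r"
  using assms unfolding ribbons_def quotient_def by auto

section \<open>Geometry of a single ribbon\<close>

lemma ribbon_parallel:
  assumes pp: "parallelogram_placement V E \<rho>" and r: "r \<in> ribbons E"
    and ab: "{a, b} \<in> r" and e: "{x, y} \<in> r"
  shows "\<rho> y - \<rho> x = \<rho> b - \<rho> a \<or> \<rho> x - \<rho> y = \<rho> b - \<rho> a"
proof -
  have "({a, b}, {x, y}) \<in> (opposite_rel E)\<^sup>*"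
    using e ribbon_eq_class[OF r ab] by blast
  \<comment> \<open>The orientation is quantified existentially because the chain consists of
    unordered edges; this is the origin of the two signs in the conclusion.\<close>
  then have "\<exists>p q. {x, y} = {p, q} \<and> \<rho> q - \<rho> p = \<rho> b - \<rho> a"
  proof (induction rule: rtrancl_induct)
    case base
    then show ?case by blast
  next
    case (step f g)
    then obtain p q where pq: "f = {p, q}" "\<rho> q - \<rho> p = \<rho> b - \<rho> a" by blast
    with step obtain c d where cd: "four_cycle E p q c d" "g = {c, d}"
      using opposite_rel_from by metis
    then have "\<rho> q - \<rho> p = \<rho> c - \<rho> d"
      using pp unfolding parallelogram_placement_def by blast
    with pq cd show ?case
      by (metis insert_commute)
  qed
  then show ?thesis
    by (auto simp: doubleton_eq_iff)
qed

text \<open>Two adjacent edges of a parallelogram that are parallel and equally long would make it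
  degenerate: either sign identifies the images of two opposite corners, against
  injectivity.\<close>

lemma ribbon_adjacent_edge:
  assumes pp: "parallelogram_placement V E \<rho>" and r: "r \<in> ribbons E"
    and fc: "four_cycle E x y c d" and e: "{x, y} \<in> r"
  shows "{y, c} \<notin> r"
proof
  assume yc: "{y, c} \<in> r"
  have inV: "x \<in> V" "y \<in> V" "c \<in> V" "d \<in> V"
    using pp fc
    unfolding parallelogram_placement_def connected_graph_def simple_graph_def four_cycle_def
    by (metis doubleton_eq_iff)+
  have inj: "inj_on \<rho> V" and par: "\<rho> y - \<rho> x = \<rho> c - \<rho> d"
    using pp fc unfolding parallelogram_placement_def by auto
  from ribbon_parallel[OF pp r e yc] show False
  proof
    assume "\<rho> c - \<rho> y = \<rho> y - \<rho> x"
    with par have "\<rho> d = \<rho> y" by simp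
    then show False
      using inj inV fc by (auto simp: inj_on_def four_cycle_def)
  next
    assume "\<rho> y - \<rho> c = \<rho> y - \<rho> x"
    then have "\<rho> c = \<rho> x" by simp
    then show False
      using inj inV fc by (auto simp: inj_on_def four_cycle_def)
  qed
qed

text \<open>When the chain passes from \<open>{x, y}\<close> to \<open>{c, d}\<close>, the
  connecting edges \<open>{y, c}\<close> and \<open>{x, d}\<close> are outside \<open>r\<close>, so
  each end moves within its component of \<open>G - r\<close>, and the parallelogram preserves the
  displacement.\<close>

lemma ribbon_joins_two_components:
  assumes pp: "parallelogram_placement V E \<rho>" and r: "r \<in> ribbons E"
    and ab: "{a, b} \<in> r" and e: "e \<in> r"
  shows "\<exists>x y. e = {x, y} \<and> (a, x) \<in> (adj_rel (E - r))\<^sup>* \<and> (b, y) \<in> (adj_rel (E - r))\<^sup>* \<and>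
           \<rho> y - \<rho> x = \<rho> b - \<rho> a"
proof -
  have "({a, b}, e) \<in> (opposite_rel E)\<^sup>*"
    using e ribbon_eq_class[OF r ab] by blast
  then show ?thesis
  proof (induction rule: rtrancl_induct)
    case base
    then show ?case by blast
  next
    case (step f g)
    then obtain x y where xy: "f = {x, y}" "(a, x) \<in> (adj_rel (E - r))\<^sup>*"
      "(b, y) \<in> (adj_rel (E - r))\<^sup>*" "\<rho> y - \<rho> x = \<rho> b - \<rho> a"
      by blast
    with step obtain c d where cd: "four_cycle E x y c d" "g = {c, d}"
      using opposite_rel_from by metis
    have fr: "{x, y} \<in> r"
      using step(1) xy(1) ribbon_eq_class[OF r ab] by blast
    have "{y, c} \<notin> r"
      using ribbon_adjacent_edge[OF pp r cd(1) fr] .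
    moreover have "{x, d} \<notin> r"
      using ribbon_adjacent_edge[OF pp r four_cycle_reverse[OF cd(1)]] fr
      by (simp add: insert_commute)
    ultimately have "(y, c) \<in> adj_rel (E - r)" "(x, d) \<in> adj_rel (E - r)"
      using cd(1) by (auto simp: adj_rel_def four_cycle_def insert_commute)
    then have "(b, c) \<in> (adj_rel (E - r))\<^sup>*" "(a, d) \<in> (adj_rel (E - r))\<^sup>*"
      using xy by (auto intro: rtrancl_into_rtrancl)
    moreover have "\<rho> y - \<rho> x = \<rho> c - \<rho> d"
      using pp cd(1) unfolding parallelogram_placement_def by blast
    ultimately show ?case
      using cd(2) xy(4) by (metis insert_commute)
  qed
qed

section \<open>The two sides of a ribbon\<close>

text \<open>A detour around one edge of \<open>r\<close> yields a detour around every edge of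
  \<open>r\<close>, and then removing \<open>r\<close> would not disconnect the graph.\<close>

lemma ribbon_end_points_separated:
  assumes pf: "P_framework V E \<rho>" and r: "r \<in> ribbons E" and ab: "{a, b} \<in> r"
  shows "(a, b) \<notin> (adj_rel (E - r))\<^sup>*"
proof
  let ?R = "(adj_rel (E - r))\<^sup>*"
  assume con: "(a, b) \<in> ?R"
  have pp: "parallelogram_placement V E \<rho>" and cg: "connected_graph V E"
    and cut: "\<not> connected_graph V (E - r)"
    using pf r by (auto simp: P_framework_def ribbon_cutting_def edge_cut_def)
  have "(x, y) \<in> ?R" if xy: "(x, y) \<in> adj_rel E" for x y
  proof (cases "{x, y} \<in> r")
    case True
    then obtain p q where "{x, y} = {p, q}" "(a, p) \<in> ?R" "(b, q) \<in> ?R"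
      using ribbon_joins_two_components[OF pp r ab] by blast
    with con show ?thesis
      by (metis adj_rtrancl_sym doubleton_eq_iff rtrancl_trans)
  next
    case False
    then show ?thesis
      using xy by (auto simp: adj_rel_def)
  qed
  then have "(adj_rel E)\<^sup>* \<subseteq> ?R"
    by (intro rtrancl_subset_rtrancl) auto
  \<comment> \<open>Simplicity and \<open>V \<noteq> {}\<close> are inherited from \<open>E\<close>,
    so only reachability was at stake.\<close>
  then have "connected_graph V (E - r)"
    using cg unfolding connected_graph_def simple_graph_def by blast
  with cut show False ..
qed

text \<open>\<open>S\<close> is the component of \<open>G - r\<close> at the end \<open>b\<close> of
  a chosen edge \<open>{a, b}\<close> of \<open>r\<close>, and \<open>w\<close> is the displacement
  from \<open>a\<close> to \<open>b\<close>.\<close>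

lemma ribbon_sides:
  assumes pf: "P_framework V E \<rho>" and r: "r \<in> ribbons E"
  shows "\<exists>S w. (\<forall>x y. {x, y} \<in> E \<longrightarrow> ({x, y} \<in> r \<longleftrightarrow> (x \<in> S) \<noteq> (y \<in> S))) \<and>
               (\<forall>x y. {x, y} \<in> r \<longrightarrow> x \<notin> S \<longrightarrow> y \<in> S \<longrightarrow> \<rho> y - \<rho> x = w)"
proof -
  let ?R = "(adj_rel (E - r))\<^sup>*"
  have pp: "parallelogram_placement V E \<rho>" and sg: "simple_graph V E"
    using pf by (auto simp: P_framework_def parallelogram_placement_def connected_graph_def)
  obtain a b where ab: "{a, b} \<in> r"
    using ribbon_obtain_edge[OF r] sg unfolding simple_graph_def by metis
  define S where "S = ?R `` {b}"
  have sep: "(a, b) \<notin> ?R"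
    using ribbon_end_points_separated[OF pf r ab] .
  have across: "\<exists>p q. {x, y} = {p, q} \<and> p \<notin> S \<and> q \<in> S \<and> \<rho> q - \<rho> p = \<rho> b - \<rho> a"
    if xy: "{x, y} \<in> r" for x y
  proof -
    obtain p q where pq: "{x, y} = {p, q}" "(a, p) \<in> ?R" "(b, q) \<in> ?R"
      "\<rho> q - \<rho> p = \<rho> b - \<rho> a"
      using ribbon_joins_two_components[OF pp r ab xy] by blast
    have "(b, p) \<notin> ?R"
      using sep pq(2) adj_rtrancl_sym rtrancl_trans by metis
    with pq show ?thesis by (auto simp: S_def)
  qed
  have within: "x \<in> S \<longleftrightarrow> y \<in> S" if "{x, y} \<in> E" "{x, y} \<notin> r" for x y
  proof -
    have "(x, y) \<in> adj_rel (E - r)" "(y, x) \<in> adj_rel (E - r)"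
      using that by (auto simp: adj_rel_def insert_commute)
    then show ?thesis
      by (auto simp: S_def intro: rtrancl_into_rtrancl)
  qed
  have "{x, y} \<in> r \<longleftrightarrow> (x \<in> S) \<noteq> (y \<in> S)" if "{x, y} \<in> E" for x y
    using across[of x y] within[OF that] by (auto simp: doubleton_eq_iff)
  moreover have "\<rho> y - \<rho> x = \<rho> b - \<rho> a" if "{x, y} \<in> r" "x \<notin> S" "y \<in> S" for x y
    using across[OF that(1)] that(2,3) by (auto simp: doubleton_eq_iff)
  ultimately show ?thesis by blast
qed

section \<open>Absence of 3-cycles\<close>

lemma P_framework_no_three_cycle:
  assumes pf: "P_framework V E \<rho>"
  shows "\<not> three_cycle E a b c"
proof
  assume "three_cycle E a b c"
  then have E: "{a, b} \<in> E" "{b, c} \<in> E" "{c, a} \<in> E"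
    by (auto simp: three_cycle_def)
  \<comment> \<open>A closed walk ends on the side of \<open>r\<close> where it began, so
    \<open>r\<close> contains none or two of the three edges.\<close>
  have parity: "({a, b} \<in> r) = (({b, c} \<in> r) \<noteq> ({c, a} \<in> r))" if r: "r \<in> ribbons E" for r
  proof -
    obtain S where "\<And>x y. {x, y} \<in> E \<Longrightarrow> {x, y} \<in> r \<longleftrightarrow> (x \<in> S) \<noteq> (y \<in> S)"
      using ribbon_sides[OF pf r] by blast
    from this[OF E(1)] this[OF E(2)] this[OF E(3)] show ?thesis by blast
  qed
  obtain r where r: "r \<in> ribbons E" "{a, b} \<in> r"
    using ribbon_of_edge[OF E(1)] by blast
  obtain s where s: "s \<in> ribbons E" "{b, c} \<in> s"
    using ribbon_of_edge[OF E(2)] by blast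
  obtain t where t: "t \<in> ribbons E" "{c, a} \<in> t"
    using ribbon_of_edge[OF E(3)] by blast
  \<comment> \<open>The ribbon of each edge must contain a second one. The three alternatives
    together force \<open>r = s = t\<close>, a ribbon with three edges of the triangle, which parity
    forbids.\<close>
  have "r = s \<or> r = t"
    using parity[OF r(1)] r s t ribbon_disjoint[OF r(1)] by blast
  moreover have "r = s \<or> s = t"
    using parity[OF s(1)] r s t ribbon_disjoint[OF s(1)] by blast
  moreover have "r = t \<or> s = t"
    using parity[OF t(1)] r s t ribbon_disjoint[OF t(1)] by blast
  ultimately show False
    using parity[OF r(1)] r(2) s(2) t(2) by blast
qed

section \<open>Separation of vertices\<close>

text \<open>
  The displacement along an edge of \<open>r\<close> is the difference of a potential \<open>\<phi> r\<close> that is constant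
  on the components of \<open>G - r\<close>.
\<close>

lemma ribbon_potential:
  assumes pf: "P_framework V E \<rho>"
  obtains \<phi> :: "'a set set \<Rightarrow> 'a \<Rightarrow> real^2" where
    "\<And>r x y. r \<in> ribbons E \<Longrightarrow> {x, y} \<in> r \<Longrightarrow> {x, y} \<in> E \<Longrightarrow> \<phi> r y - \<phi> r x = \<rho> y - \<rho> x"
    "\<And>r x y. r \<in> ribbons E \<Longrightarrow> {x, y} \<in> E \<Longrightarrow> {x, y} \<notin> r \<Longrightarrow> \<phi> r y = \<phi> r x"
proof -
  have "\<exists>f. (\<forall>x y. {x, y} \<in> r \<longrightarrow> {x, y} \<in> E \<longrightarrow> f y - f x = \<rho> y - \<rho> x) \<and>
            (\<forall>x y. {x, y} \<in> E \<longrightarrow> {x, y} \<notin> r \<longrightarrow> f y = f x)"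
    if r: "r \<in> ribbons E" for r
  proof -
    obtain S w where S: "\<And>x y. {x, y} \<in> E \<Longrightarrow> {x, y} \<in> r \<longleftrightarrow> (x \<in> S) \<noteq> (y \<in> S)"
      and w: "\<And>x y. {x, y} \<in> r \<Longrightarrow> x \<notin> S \<Longrightarrow> y \<in> S \<Longrightarrow> \<rho> y - \<rho> x = w"
      using ribbon_sides[OF pf r] by blast
    \<comment> \<open>Entering \<open>S\<close> gains \<open>w\<close> and leaving it loses
      \<open>w\<close>, as the displacements along edges of \<open>r\<close> do.\<close>
    define f where "f x = (if x \<in> S then w else 0)" for x
    have "f y - f x = \<rho> y - \<rho> x" if xy: "{x, y} \<in> r" "{x, y} \<in> E" for x y
    proof (cases "x \<in> S")
      case True
      with S xy have y: "y \<notin> S" by blast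
      have "\<rho> x - \<rho> y = w"
        using w[of y x] xy True y by (simp add: insert_commute)
      with True y show ?thesis by (auto simp: f_def)
    next
      case False
      with S xy have "y \<in> S" by blast
      with False w xy show ?thesis by (simp add: f_def)
    qed
    moreover have "f y = f x" if "{x, y} \<in> E" "{x, y} \<notin> r" for x y
      using S that by (auto simp: f_def)
    ultimately show ?thesis by blast
  qed
  then show thesis
    using that by metis
qed

text \<open>The potential differences of all ribbons add up to \<open>\<rho> v - \<rho> u\<close>,
  which is nonzero by injectivity. Hence some \<open>\<phi> r\<close> differs at \<open>u\<close>
  and \<open>v\<close>, while it is constant along walks avoiding \<open>r\<close>.\<close>

lemma P_framework_separation:
  assumes pf: "P_framework V E \<rho>" and uv: "u \<in> V" "v \<in> V" "u \<noteq> v"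
  obtains r where "r \<in> ribbons E" "(u, v) \<notin> (adj_rel (E - r))\<^sup>*"
proof -
  obtain \<phi> :: "'a set set \<Rightarrow> 'a \<Rightarrow> real^2" where
    \<phi>_in: "\<And>r x y. r \<in> ribbons E \<Longrightarrow> {x, y} \<in> r \<Longrightarrow> {x, y} \<in> E \<Longrightarrow>
        \<phi> r y - \<phi> r x = \<rho> y - \<rho> x" and
    \<phi>_out: "\<And>r x y. r \<in> ribbons E \<Longrightarrow> {x, y} \<in> E \<Longrightarrow> {x, y} \<notin> r \<Longrightarrow> \<phi> r y = \<phi> r x"
    using ribbon_potential[OF pf] by blast
  have "(u, v) \<in> (adj_rel E)\<^sup>*"
    using pf uv by (auto simp: P_framework_def ribbon_cutting_def connected_graph_def)
  \<comment> \<open>There may be infinitely many ribbons, so the induction carries a finite set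
    outside of which the potentials agree at both ends of the walk.\<close>
  then have "\<exists>R. finite R \<and> R \<subseteq> ribbons E \<and> \<rho> v - \<rho> u = (\<Sum>r\<in>R. \<phi> r v - \<phi> r u) \<and>
      (\<forall>r\<in>ribbons E - R. \<phi> r v = \<phi> r u)"
  proof (induction rule: rtrancl_induct)
    case base
    then show ?case by (intro exI[of _ "{}"]) simp
  next
    case (step x y)
    then obtain R where R: "finite R" "R \<subseteq> ribbons E" "\<rho> x - \<rho> u = (\<Sum>r\<in>R. \<phi> r x - \<phi> r u)"
      "\<forall>r\<in>ribbons E - R. \<phi> r x = \<phi> r u" by blast
    have e: "{x, y} \<in> E"
      using step by (simp add: adj_rel_def)
    obtain s where s: "s \<in> ribbons E" "{x, y} \<in> s"
      using ribbon_of_edge[OF e] by blast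
    have other: "\<phi> r y = \<phi> r x" if "r \<in> ribbons E" "r \<noteq> s" for r
      using \<phi>_out[OF that(1) e] ribbon_disjoint[OF that(1) s(1)] that(2) s(2) by blast
    \<comment> \<open>\<open>s\<close> may or may not occur in \<open>R\<close> already. Enlarging
      the old sum to \<open>?T\<close> is harmless, since a new \<open>s\<close> contributes zero to
      it.\<close>
    let ?T = "insert s R"
    have "(\<Sum>r\<in>?T. \<phi> r y - \<phi> r u) = (\<Sum>r\<in>?T. \<phi> r y - \<phi> r x) + (\<Sum>r\<in>?T. \<phi> r x - \<phi> r u)"
      by (simp flip: sum.distrib)
    also have "(\<Sum>r\<in>?T. \<phi> r x - \<phi> r u) = \<rho> x - \<rho> u"
      unfolding R(3) using R(1,4) s(1) by (intro sum.mono_neutral_right) auto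
    \<comment> \<open>Only the ribbon \<open>s\<close> of the new edge changes its potential along
      that edge.\<close>
    also have "(\<Sum>r\<in>?T. \<phi> r y - \<phi> r x) = (\<Sum>r\<in>{s}. \<phi> r y - \<phi> r x)"
      using R(1,2) other by (intro sum.mono_neutral_right) auto
    also have "\<dots> = \<rho> y - \<rho> x"
      using \<phi>_in[OF s e] by simp
    finally have "\<rho> y - \<rho> u = (\<Sum>r\<in>?T. \<phi> r y - \<phi> r u)" by simp
    moreover have "\<forall>r\<in>ribbons E - ?T. \<phi> r y = \<phi> r u"
      using R(4) other by auto
    ultimately show ?case
      using R(1,2) s(1) by (intro exI[of _ ?T]) auto
  qed
  then obtain R where R: "R \<subseteq> ribbons E" "\<rho> v - \<rho> u = (\<Sum>r\<in>R. \<phi> r v - \<phi> r u)"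
    by blast
  have "\<rho> v \<noteq> \<rho> u"
    using pf uv by (auto simp: P_framework_def parallelogram_placement_def inj_on_def)
  with R(2) have "(\<Sum>r\<in>R. \<phi> r v - \<phi> r u) \<noteq> 0" by (metis right_minus_eq)
  then obtain r where "r \<in> R" "\<phi> r v - \<phi> r u \<noteq> 0"
    by (rule sum.not_neutral_contains_not_neutral)
  with R(1) have r: "r \<in> ribbons E" "\<phi> r v \<noteq> \<phi> r u" by auto
  have "\<phi> r y = \<phi> r u" if "(u, y) \<in> (adj_rel (E - r))\<^sup>*" for y
    using that
  proof (induction rule: rtrancl_induct)
    case (step x y)
    then show ?case
      using \<phi>_out[OF r(1), of x y] by (simp add: adj_rel_def)
  qed simp
  with r show thesis
    using that by blast
qed

theorem theorem3p9:
  fixes V :: "'a set" and E :: "'a set set" and \<rho> :: "'a \<Rightarrow> real^2"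
  assumes "P_framework V E \<rho>"
  shows "(\<nexists>u1 u2 u3. three_cycle E u1 u2 u3) \<and>
         (\<forall>u\<in>V. \<forall>v\<in>V. u \<noteq> v \<longrightarrow> (\<exists>r\<in>ribbons E. in_different_components V (E - r) u v))"
proof (intro conjI ballI impI)
  show "\<nexists>u1 u2 u3. three_cycle E u1 u2 u3"
    using P_framework_no_three_cycle[OF assms] by blast
next
  fix u v
  assume uv: "u \<in> V" "v \<in> V" "u \<noteq> v"
  obtain r where r: "r \<in> ribbons E" "(u, v) \<notin> (adj_rel (E - r))\<^sup>*"
    using P_framework_separation[OF assms uv] .
  let ?C = "\<lambda>x. (adj_rel (E - r))\<^sup>* `` {x}"
  have "?C u \<in> connected_components V (E - r)" "?C v \<in> connected_components V (E - r)"
    using uv by (auto simp: connected_components_def quotient_def)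
  moreover have "u \<in> ?C u" "v \<in> ?C v" "?C u \<noteq> ?C v"
    using r(2) by auto
  ultimately have "in_different_components V (E - r) u v"
    unfolding in_different_components_def by blast
  with r(1) show "\<exists>r\<in>ribbons E. in_different_components V (E - r) u v" ..
qed

end
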